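(* There exist a compact (Hausdorff) topological space $X$, a completely metrizable subspace $E$ of $X$, and a continuous function $f:E\to[0,1]$ which cannot be extended to a Lebesgue class one function on $X$; that is, there is no Lebesgue class one function $g:X\to[0,1]$ with $g|_E=f$.
   Context: All topological spaces are assumed to be Hausdorff. A mapping $g:X\to Y$ between topological spaces is of the first Lebesgue class (Lebesgue class one) if for every open set $V\subseteq Y$ the preimage $g^{-1}(V)$ is an $F_\sigma$-set in $X$. *)

theory Defs
  imports "HOL-Analysis.Analysis"
begin

definition lebesgue_class_one :: "'a topology \<Rightarrow> 'b topology \<Rightarrow> ('a \<Rightarrow> 'b) \<Rightarrow> bool" where
  "lebesgue_class_one X Y g \<longleftrightarrow>
     g \<in> topspace X \<rightarrow> topspace Y \<and>
     (\<forall>V. openin Y V \<longrightarrow> fsigma_in X {x \<in> topspace X. g x \<in> V})"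

(* HOL cannot quantify existentially over types, so an existence statement about spaces names
   the type the points are drawn from.  If that type is real, X is an arbitrary topology on
   an arbitrary set of reals, unrelated to the usual topology.  This asserts no less than
   existence of an arbitrary space: it adds that one of cardinality at most the continuum
   suffices. *)

end

theory Submission
  imports Defs
begin

text \<open>The idea is that in the one-point compactification \<open>E \<union> {p}\<close> of an uncountable discrete
  space \<open>E\<close>, a closed set that misses \<open>p\<close> is finite, so an \<open>F\<^sub>\<sigma>\<close>-set that misses \<open>p\<close> is
  countable.  Hence a function of the first Lebesgue class is equal to its value at \<open>p\<close> at all but
  countably many points: the open set of values different from \<open>g p\<close> has a preimage that is
  \<open>F\<^sub>\<sigma>\<close> and misses \<open>p\<close>.  On the other hand \<open>E\<close> is discrete, hence completely
  metrizable, and every function on it is continuous, in particular one that takes both values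
  \<open>0\<close> and \<open>1\<close> uncountably often.  Such a function has no extension of the first Lebesgue class.
  Here \<open>E\<close> consists of the nonzero reals, \<open>p = 0\<close>, and the function is the indicator of the
  positive reals.\<close>

text \<open>The one-point compactification of a discrete space (Fort space), built on the type itself:
  the given point \<open>p\<close> plays the role of infinity, so that no new point has to be adjoined.\<close>

definition fort_topology :: "'a \<Rightarrow> 'a topology" where
  "fort_topology p = topology (\<lambda>U. p \<in> U \<longrightarrow> finite (- U))"

lemma openin_fort_topology: "openin (fort_topology p) U \<longleftrightarrow> (p \<in> U \<longrightarrow> finite (- U))"
proof -
  have "istopology (\<lambda>U. p \<in> U \<longrightarrow> finite (- U))"
    unfolding istopology_def
  proof (intro conjI allI impI)
    fix S T :: "'a set"
    assume "p \<in> S \<longrightarrow> finite (- S)" "p \<in> T \<longrightarrow> finite (- T)" "p \<in> S \<inter> T"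
    then show "finite (- (S \<inter> T))"
      by (simp add: Compl_Int)
  next
    fix \<K> :: "'a set set"
    assume K: "\<forall>K\<in>\<K>. p \<in> K \<longrightarrow> finite (- K)" and "p \<in> \<Union>\<K>"
    then obtain K where "K \<in> \<K>" "finite (- K)"
      by blast
    then show "finite (- \<Union>\<K>)"
      by (metis Compl_anti_mono Union_upper finite_subset)
  qed
  then show ?thesis
    by (simp add: fort_topology_def)
qed

lemma topspace_fort_topology [simp]: "topspace (fort_topology p) = UNIV"
  using openin_subset[of "fort_topology p" UNIV] by (auto simp: openin_fort_topology)

lemma closedin_fort_topology: "closedin (fort_topology p) C \<longleftrightarrow> p \<in> C \<or> finite C"
  by (auto simp: closedin_def openin_fort_topology Compl_eq_Diff_UNIV[symmetric])

lemma compact_space_fort_topology: "compact_space (fort_topology p)"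
  unfolding compact_space_alt
proof (intro allI impI)
  fix \<U> :: "'a set set"
  assume "(\<forall>U\<in>\<U>. openin (fort_topology p) U) \<and> topspace (fort_topology p) \<subseteq> \<Union>\<U>"
  then have U: "\<forall>U\<in>\<U>. openin (fort_topology p) U" and cov: "UNIV \<subseteq> \<Union>\<U>"
    by auto
  then obtain W where W: "W \<in> \<U>" "p \<in> W"
    by auto
  with U have "finite (- W)"
    by (auto simp: openin_fort_topology)
  moreover have "- W \<subseteq> \<Union>\<U>"
    using cov by auto
  ultimately obtain \<F> where "finite \<F>" "\<F> \<subseteq> \<U>" "- W \<subseteq> \<Union>\<F>"
    using finite_subset_Union by metis
  with W show "\<exists>\<F>. finite \<F> \<and> \<F> \<subseteq> \<U> \<and> topspace (fort_topology p) \<subseteq> \<Union>\<F>"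
    by (intro exI[of _ "insert W \<F>"]) auto
qed

text \<open>One of two distinct points differs from \<open>p\<close>, and its singleton is both open and closed.\<close>

lemma Hausdorff_space_fort_topology: "Hausdorff_space (fort_topology p)"
  unfolding Hausdorff_space_def
proof (intro allI impI)
  fix x y :: 'a
  assume "x \<in> topspace (fort_topology p) \<and> y \<in> topspace (fort_topology p) \<and> x \<noteq> y"
  then have "x \<noteq> y" by simp
  show "\<exists>U V. openin (fort_topology p) U \<and> openin (fort_topology p) V \<and> x \<in> U \<and> y \<in> V \<and> disjnt U V"
  proof (cases "x = p")
    case True
    with \<open>x \<noteq> y\<close> show ?thesis
      by (intro exI[of _ "- {y}"] exI[of _ "{y}"]) (auto simp: openin_fort_topology disjnt_def)
  next
    case False
    with \<open>x \<noteq> y\<close> show ?thesis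
      by (intro exI[of _ "{x}"] exI[of _ "- {x}"]) (auto simp: openin_fort_topology disjnt_def)
  qed
qed

lemma subtopology_fort_topology:
  "subtopology (fort_topology p) (- {p}) = discrete_topology (- {p})"
  by (rule sym, subst discrete_topology_unique)
    (auto simp: openin_subtopology openin_fort_topology intro!: exI[of _ "{_}"])

lemma fsigma_in_fort_topology_imp_countable:
  assumes "fsigma_in (fort_topology p) S" "p \<notin> S"
  shows "countable S"
proof -
  obtain \<C> where "countable \<C>" and C: "\<And>C. C \<in> \<C> \<Longrightarrow> closedin (fort_topology p) C" "\<Union>\<C> = S"
    using assms(1) unfolding fsigma_in_def union_of_def by auto
  moreover have "countable C" if "C \<in> \<C>" for C
    using C that \<open>p \<notin> S\<close> by (auto simp: closedin_fort_topology intro: countable_finite)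
  ultimately show ?thesis
    using C(2) countable_UN[of \<C> "\<lambda>C. C"] by simp
qed

lemma lebesgue_class_one_fort_topology_imp_countable:
  assumes "lebesgue_class_one (fort_topology p) Y g" and "t1_space Y"
  shows "countable {x. g x \<noteq> g p}"
proof -
  let ?V = "topspace Y - {g p}"
  have range: "g x \<in> topspace Y" for x
    using assms(1) by (auto simp: lebesgue_class_one_def)
  then have "openin Y ?V"
    using \<open>t1_space Y\<close> by (simp add: t1_space_openin_delete_alt)
  then have "fsigma_in (fort_topology p) {x. g x \<in> ?V}"
    using assms(1) by (auto simp: lebesgue_class_one_def)
  then have "countable {x. g x \<in> ?V}"
    by (rule fsigma_in_fort_topology_imp_countable) simp
  then show ?thesis
    using range by simp
qed

theorem mainTheorem3:
  shows "\<exists>(X :: real topology) (E :: real set) (f :: real \<Rightarrow> real).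
           compact_space X \<and> Hausdorff_space X \<and>
           E \<subseteq> topspace X \<and> completely_metrizable_space (subtopology X E) \<and>
           continuous_map (subtopology X E) (top_of_set {0..1}) f \<and>
           \<not> (\<exists>g :: real \<Rightarrow> real.
                 lebesgue_class_one X (top_of_set {0..1}) g \<and> (\<forall>x\<in>E. g x = f x))"
proof (intro exI conjI)
  let ?X = "fort_topology (0::real)" and ?E = "- {0::real}" and ?f = "indicat_real {0<..}"
  show "compact_space ?X" "Hausdorff_space ?X" "?E \<subseteq> topspace ?X"
    by (simp_all add: compact_space_fort_topology Hausdorff_space_fort_topology)
  show "completely_metrizable_space (subtopology ?X ?E)"
    by (simp add: subtopology_fort_topology completely_metrizable_space_discrete_topology)
  show "continuous_map (subtopology ?X ?E) (top_of_set {0..1}) ?f"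
    by (auto simp: subtopology_fort_topology indicator_def)
  show "\<not> (\<exists>g. lebesgue_class_one ?X (top_of_set {0..1}) g \<and> (\<forall>x\<in>?E. g x = ?f x))"
  proof
    assume "\<exists>g. lebesgue_class_one ?X (top_of_set {0..1}) g \<and> (\<forall>x\<in>?E. g x = ?f x)"
    then obtain g where g: "lebesgue_class_one ?X (top_of_set {0..1}) g"
      and ext: "\<And>x. x \<noteq> 0 \<Longrightarrow> g x = ?f x"
      by auto
    have "t1_space (top_of_set {0..1::real})"
      by (intro Hausdorff_imp_t1_space Hausdorff_space_subtopology Hausdorff_space_euclidean)
    with g have count: "countable {x. g x \<noteq> g 0}"
      by (rule lebesgue_class_one_fort_topology_imp_countable)
    have "{0<..<1} \<subseteq> {x. g x \<noteq> g 0} \<or> {-1<..<0} \<subseteq> {x. g x \<noteq> g 0}"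
      by (cases "g 0 = 0") (auto simp: ext)
    with count have "countable {0<..<1::real} \<or> countable {-1<..<0::real}"
      by (meson countable_subset)
    then show False
      using uncountable_open_interval[of 0 "1::real"] uncountable_open_interval[of "-1" "0::real"] by simp
  qed
qed

end
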